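(* Let $(L,[\cdot,\dots,\cdot],\varepsilon,\alpha,\beta)$ be an $n$-BiHom-Lie color algebra, let $(M,\alpha_M,\beta_M,\omega_i)$ be an $n$-BiHom-Lie (color) module over $L$, and let $\gamma:L\to L$ be an endomorphism of $L$. Define, for $i=1,\dots,n$, $$\tilde\omega_i(x_1,\dots,x_{i-1},m,x_{i+1},\dots,x_n)=\omega_i(\gamma(x_1),\dots,\gamma(x_{i-1}),m,\gamma(x_{i+1}),\dots,\gamma(x_n)).$$ Then $(M,\alpha_M,\beta_M,\tilde\omega_i)$ is an $n$-BiHom-Lie (color) module over $L$.
   Context: $\mathbb K$ is a field of characteristic different from $2$, $\Gamma$ is an abelian group (written additively) with identity element $e$, and all spaces are $\Gamma$-graded $\mathbb K$-vector spaces; $\mathcal H(V)$ is the set of homogeneous elements of $V$. A (skew-symmetric) bicharacter is a map $\varepsilon:\Gamma\times\Gamma\to\mathbb K^*$ with $\varepsilon(a,b)\varepsilon(b,a)=1$, $\varepsilon(a,b+c)=\varepsilon(a,b)\varepsilon(a,c)$, $\varepsilon(a+b,c)=\varepsilon(a,c)\varepsilon(b,c)$. Inside $\varepsilon$ and inside sums of arguments of $\varepsilon$, a homogeneous element stands for its degree. A (multi)linear map is even if it has degree zero. An $n$-BiHom-Lie color algebra is a $5$-tuple $(L,[\cdot,\dots,\cdot],\varepsilon,\alpha,\beta)$ with $L$ a $\Gamma$-graded vector space, $[\cdot,\dots,\cdot]:L\times\dots\times L\to L$ an even $n$-linear map, $\varepsilon$ a bicharacter and $\alpha,\beta:L\to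 L$ even linear maps such that, for all homogeneous elements: (1) $\alpha\circ\beta=\beta\circ\alpha$; (2) $[\beta(x_1),\dots,\beta(x_k),\beta(x_{k+1}),\dots,\beta(x_{n-1}),\alpha(x_n)]=-\varepsilon(x_k,x_{k+1})[\beta(x_1),\dots,\beta(x_{k+1}),\beta(x_k),\dots,\beta(x_{n-1}),\alpha(x_n)]$ for $k=1,\dots,n-2$, and $[\beta(x_1),\dots,\beta(x_{n-1}),\alpha(x_n)]=-\varepsilon(x_{n-1},x_n)[\beta(x_1),\dots,\beta(x_{n-2}),\beta(x_n),\alpha(x_{n-1})]$; (3) $[\beta^2(x_1),\dots,\beta^2(x_{n-1}),[\beta(y_1),\dots,\beta(y_{n-1}),\alpha(y_n)]]=\sum_{k=1}^n\varepsilon(X,Y_k)[\beta^2(y_1),\dots,\beta^2(y_{k-1}),[\beta(x_1),\dots,\beta(x_{n-1}),\alpha(y_k)],\beta^2(y_{k+1}),\dots,\beta^2(y_n)]$, where $X=\sum_{k=1}^{n-1}x_k$ and $Y_k=\sum_{l=1}^{k}y_{l-1}$ with $y_0=e$ (so $Y_k$ is the sum of the degrees of $y_1,\dots,y_{k-1}$). An endomorphism of $L$ is an even linear map $\gamma:L\to L$ with $\gamma\alpha=\alpha\gamma$, $\gamma\beta=\beta\gamma$ and $\gamma([x_1,\dots,x_n])=[\gamma(x_1),\dots,\gamma(x_n)]$. A BiHom-module is a triple $(M,\alpha_M,\beta_M)$ with $M$ a $\Gamma$-graded vector space and $\alpha_M,\beta_M:M\to M$ even linear maps with $\alpha_M\beta_M=\beta_M\alpha_M$.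 It is an $n$-BiHom-Lie module over $L$ if there are $n$ multilinear maps $\omega_i:L\otimes\dots\otimes L\otimes M\otimes L\otimes\dots\otimes L\to M$ ($M$ in position $i$), $i=1,\dots,n$, such that for all $x_j,y_j\in\mathcal H(L)$, $m\in\mathcal H(M)$: (a) $\omega_i(\beta(x_1),\dots,\beta(x_{i-1}),\beta_M(m),\beta(x_{i+1}),\dots,\alpha(x_n))$ is $\varepsilon$-skew-symmetric in all the $x$-type arguments; (b) $\omega_i(\beta(x_1),\dots,\beta(x_{i-1}),\beta_M(m),\beta(x_{i+1}),\dots,\alpha(x_n))=-\varepsilon(m,x_{i+1})\,\omega_{i+1}(\beta(x_1),\dots,\beta(x_{i-1}),\beta(x_{i+1}),\beta_M(m),\dots,\alpha(x_n))$ for $i=1,\dots,n-2$, and $\omega_{n-1}(\beta(x_1),\dots,\beta(x_{n-2}),\beta_M(m),\alpha(x_n))=-\varepsilon(m,x_n)\,\omega_n(\beta(x_1),\dots,\beta(x_{n-2}),\beta(x_n),\alpha_M(m))$; (c) $\omega_n(\beta^2(x_1),\dots,\beta^2(x_{n-1}),\omega_n(\beta(y_1),\dots,\beta(y_{n-1}),\alpha_M(m)))=\sum_{i=1}^{n-1}\varepsilon(X,Y_i)\,\omega_n(\beta^2(y_1),\dots,\beta^2(y_{i-1}),[\beta(x_1),\dots,\beta(x_{n-1}),\alpha(y_i)],\beta^2(y_{i+1}),\dots,\beta_M^2(m))+\varepsilon(X,Y_n)\,\omega_n(\beta^2(y_1),\dots,\beta^2(y_{n-1}),\omega_n(\beta(x_1),\dots,\beta(x_{n-1}),\alpha_M(m)))$,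 where $X=\sum_{i=1}^{n-1}x_i$ and $Y_i=\sum_{j=1}^i y_{j-1}$, $y_0=e$; (d) $\omega_{n-1}(\beta^2(x_1),\dots,\beta^2(x_{n-2}),\beta_M^2(m),[\beta(y_1),\dots,\beta(y_{n-1}),\alpha(y_n)])=\sum_{i=1}^n\varepsilon(X,Y_i)\,\omega_i(\beta^2(y_1),\dots,\beta^2(y_{i-1}),\omega_{n-1}(\beta(x_1),\dots,\beta(x_{n-2}),\beta_M(m),\alpha(y_i)),\beta^2(y_{i+1}),\dots,\beta^2(y_n))$, where $X=\sum_{i=1}^{n-2}x_i+m$ and $Y_i=\sum_{j=1}^i y_{j-1}$, $y_0=e$. *)

theory Defs
  imports Complex_Main "HOL-Combinatorics.Transposition"
begin

locale graded_vector_space = vector_space scale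
  for scale :: "'k::field \<Rightarrow> 'v::ab_group_add \<Rightarrow> 'v" +
  fixes comp :: "'g::ab_group_add \<Rightarrow> 'v set"
  assumes subspace_comp: "subspace (comp a)"
    and direct_sum: "\<exists>!f. finite {a. f a \<noteq> 0} \<and> (\<forall>a. f a \<in> comp a) \<and> (\<Sum>a | f a \<noteq> 0. f a) = v"

definition even_linear ::
  "('k::field \<Rightarrow> 'v::ab_group_add \<Rightarrow> 'v) \<Rightarrow> ('g::ab_group_add \<Rightarrow> 'v set) \<Rightarrow> ('v \<Rightarrow> 'v) \<Rightarrow> bool"
  where "even_linear s V f \<longleftrightarrow> Vector_Spaces.linear s s f \<and> (\<forall>a. \<forall>v\<in>V a. f v \<in> V a)"

text \<open>
  An argument tuple \<open>(x\<^sub>j)\<close> with positions \<open>j \<in> J\<close> is a function on \<open>nat\<close> of which only the values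
  on \<open>J\<close> matter; the first conjunct says that a multilinear map does not see the other values.
\<close>

definition multilinear_on ::
  "('k::field \<Rightarrow> 'v::ab_group_add \<Rightarrow> 'v) \<Rightarrow> ('k \<Rightarrow> 'w::ab_group_add \<Rightarrow> 'w) \<Rightarrow> nat set
    \<Rightarrow> ((nat \<Rightarrow> 'v) \<Rightarrow> 'w) \<Rightarrow> bool"
  where "multilinear_on s t J f \<longleftrightarrow>
    (\<forall>x y. (\<forall>j\<in>J. x j = y j) \<longrightarrow> f x = f y) \<and>
    (\<forall>x. \<forall>j\<in>J. Vector_Spaces.linear s t (\<lambda>u. f (x(j := u))))"

text \<open>
  In the axioms below, a homogeneous element is given together with a degree: \<open>x j \<in> V (d j)\<close>.
  The only element with several degrees is \<open>0\<close>, for which the axioms hold trivially by multilinearity.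
\<close>

locale bicharacter =
  fixes eps :: "'g::ab_group_add \<Rightarrow> 'g \<Rightarrow> 'k::field"
  assumes eps_nonzero: "eps a b \<noteq> 0"
    and eps_skew: "eps a b * eps b a = 1"
    and eps_add_right: "eps a (b + c) = eps a b * eps a c"
    and eps_add_left: "eps (a + b) c = eps a c * eps b c"

text \<open>The tuple \<open>(\<beta>(x\<^sub>1), \<dots>, \<beta>(x\<^sub>n\<^sub>-\<^sub>1), \<alpha>(x\<^sub>n))\<close>.\<close>

definition bihom_args ::
  "nat \<Rightarrow> ('v \<Rightarrow> 'v) \<Rightarrow> ('v \<Rightarrow> 'v) \<Rightarrow> (nat \<Rightarrow> 'v) \<Rightarrow> nat \<Rightarrow> 'v"
  where "bihom_args n \<alpha> \<beta> x = (\<lambda>j. if j = n then \<alpha> (x j) else \<beta> (x j))"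

locale n_bihom_lie_color_algebra = graded_vector_space sL L + bicharacter eps
  for n :: nat
    and sL :: "'k::field \<Rightarrow> 'l::ab_group_add \<Rightarrow> 'l"
    and L :: "'g::ab_group_add \<Rightarrow> 'l set"
    and br :: "(nat \<Rightarrow> 'l) \<Rightarrow> 'l"
    and eps :: "'g \<Rightarrow> 'g \<Rightarrow> 'k"
    and \<alpha> \<beta> :: "'l \<Rightarrow> 'l" +
  assumes arity: "n \<ge> 2"
    and even_alpha: "even_linear sL L \<alpha>"
    and even_beta: "even_linear sL L \<beta>"
    and multilinear_br: "multilinear_on sL sL {1..n} br"
    and even_br: "(\<And>j. j \<in> {1..n} \<Longrightarrow> x j \<in> L (d j)) \<Longrightarrow> br x \<in> L (\<Sum>j=1..n. d j)"
    and alpha_beta: "\<alpha> \<circ> \<beta> = \<beta> \<circ> \<alpha>"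
    and br_skew:
      "\<lbrakk>k \<in> {1..n - 1}; \<And>j. j \<in> {1..n} \<Longrightarrow> x j \<in> L (d j)\<rbrakk> \<Longrightarrow>
        br (bihom_args n \<alpha> \<beta> x) =
          sL (- eps (d k) (d (k + 1))) (br (bihom_args n \<alpha> \<beta> (x \<circ> transpose k (k + 1))))"
    and br_jacobi:
      "\<lbrakk>\<And>j. j \<in> {1..n - 1} \<Longrightarrow> x j \<in> L (d j); \<And>j. j \<in> {1..n} \<Longrightarrow> y j \<in> L (e j)\<rbrakk> \<Longrightarrow>
        br ((\<lambda>j. \<beta> (\<beta> (x j)))(n := br (bihom_args n \<alpha> \<beta> y))) =
          (\<Sum>k=1..n. sL (eps (\<Sum>j=1..n - 1. d j) (\<Sum>l=1..<k. e l))
            (br ((\<lambda>j. \<beta> (\<beta> (y j)))(k := br (bihom_args n \<alpha> \<beta> (x(n := y k)))))))"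

definition bihom_endomorphism ::
  "nat \<Rightarrow> ('k::field \<Rightarrow> 'l::ab_group_add \<Rightarrow> 'l) \<Rightarrow> ('g::ab_group_add \<Rightarrow> 'l set)
    \<Rightarrow> ((nat \<Rightarrow> 'l) \<Rightarrow> 'l) \<Rightarrow> ('l \<Rightarrow> 'l) \<Rightarrow> ('l \<Rightarrow> 'l) \<Rightarrow> ('l \<Rightarrow> 'l) \<Rightarrow> bool"
  where "bihom_endomorphism n sL L br \<alpha> \<beta> \<gamma> \<longleftrightarrow>
    even_linear sL L \<gamma> \<and> \<gamma> \<circ> \<alpha> = \<alpha> \<circ> \<gamma> \<and> \<gamma> \<circ> \<beta> = \<beta> \<circ> \<gamma> \<and>
    (\<forall>x. \<gamma> (br x) = br (\<lambda>j. \<gamma> (x j)))"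

locale bihom_module = graded_vector_space sM M
  for sM :: "'k::field \<Rightarrow> 'm::ab_group_add \<Rightarrow> 'm"
    and M :: "'g::ab_group_add \<Rightarrow> 'm set"
    and \<alpha>\<^sub>M \<beta>\<^sub>M :: "'m \<Rightarrow> 'm" +
  assumes even_alphaM: "even_linear sM M \<alpha>\<^sub>M"
    and even_betaM: "even_linear sM M \<beta>\<^sub>M"
    and alphaM_betaM: "\<alpha>\<^sub>M \<circ> \<beta>\<^sub>M = \<beta>\<^sub>M \<circ> \<alpha>\<^sub>M"

text \<open>
  The factor relating \<open>f(\<dots>, a\<^sub>j, \<dots>, a\<^sub>k, \<dots>)\<close> to \<open>f(\<dots>, a\<^sub>k, \<dots>, a\<^sub>j, \<dots>)\<close> for an \<open>\<epsilon>\<close>-skew-symmetric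
  map, the arguments having degrees \<open>d\<close>.  It is the product of the factors
  \<open>-\<epsilon>(a\<^sub>p, a\<^sub>q)\<close> of the \<open>2 (k - j) - 1\<close> adjacent transpositions that make up the exchange;
  for \<open>k = j + 1\<close> it is \<open>-\<epsilon>(a\<^sub>j, a\<^sub>k)\<close>.
\<close>

definition swap_factor :: "('g \<Rightarrow> 'g \<Rightarrow> 'k::field) \<Rightarrow> (nat \<Rightarrow> 'g) \<Rightarrow> nat \<Rightarrow> nat \<Rightarrow> 'k"
  where "swap_factor eps d j k =
    - eps (d j) (d k) * (\<Prod>l\<in>{j<..<k}. eps (d j) (d l) * eps (d l) (d k))"

text \<open>
  \<open>\<omega> i x m\<close> stands for \<open>\<omega>\<^sub>i(x\<^sub>1, \<dots>, x\<^sub>i\<^sub>-\<^sub>1, m, x\<^sub>i\<^sub>+\<^sub>1, \<dots>, x\<^sub>n)\<close>; the value \<open>x i\<close> is ignored.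
  In the skew-symmetry axiom the module element has the twist of its position
  (\<open>\<alpha>\<^sub>M\<close> in position \<open>n\<close>, \<open>\<beta>\<^sub>M\<close> elsewhere), and it contributes its degree to the factor
  of an exchange of two algebra elements on either side of it.
\<close>

locale n_bihom_lie_module =
  n_bihom_lie_color_algebra n sL L br eps \<alpha> \<beta> + M: bihom_module sM M \<alpha>\<^sub>M \<beta>\<^sub>M
  for n :: nat
    and sL :: "'k::field \<Rightarrow> 'l::ab_group_add \<Rightarrow> 'l"
    and L :: "'g::ab_group_add \<Rightarrow> 'l set"
    and br :: "(nat \<Rightarrow> 'l) \<Rightarrow> 'l"
    and eps :: "'g \<Rightarrow> 'g \<Rightarrow> 'k"
    and \<alpha> \<beta> :: "'l \<Rightarrow> 'l"
    and sM :: "'k \<Rightarrow> 'm::ab_group_add \<Rightarrow> 'm"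
    and M :: "'g \<Rightarrow> 'm set"
    and \<alpha>\<^sub>M \<beta>\<^sub>M :: "'m \<Rightarrow> 'm"
    and \<omega> :: "nat \<Rightarrow> (nat \<Rightarrow> 'l) \<Rightarrow> 'm \<Rightarrow> 'm" +
  assumes multilinear_action:
      "i \<in> {1..n} \<Longrightarrow> multilinear_on sL sM ({1..n} - {i}) (\<lambda>x. \<omega> i x m)"
    and linear_action:
      "i \<in> {1..n} \<Longrightarrow> Vector_Spaces.linear sM sM (\<omega> i x)"
    and action_skew:
      "\<lbrakk>i \<in> {1..n}; j \<in> {1..n} - {i}; k \<in> {1..n} - {i}; j < k;
        \<And>l. l \<in> {1..n} - {i} \<Longrightarrow> x l \<in> L (d l); m \<in> M c;
        m' = (if i = n then \<alpha>\<^sub>M m else \<beta>\<^sub>M m)\<rbrakk> \<Longrightarrow>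
        \<omega> i (bihom_args n \<alpha> \<beta> x) m' =
          sM (swap_factor eps (d(i := c)) j k) (\<omega> i (bihom_args n \<alpha> \<beta> (x \<circ> transpose j k)) m')"
    and action_shift:
      "\<lbrakk>i \<in> {1..n - 2}; \<And>l. l \<in> {1..n} - {i} \<Longrightarrow> x l \<in> L (d l); m \<in> M c\<rbrakk> \<Longrightarrow>
        \<omega> i (bihom_args n \<alpha> \<beta> x) (\<beta>\<^sub>M m) =
          sM (- eps c (d (i + 1))) (\<omega> (i + 1) (bihom_args n \<alpha> \<beta> (x(i := x (i + 1)))) (\<beta>\<^sub>M m))"
    and action_shift_last:
      "\<lbrakk>\<And>l. l \<in> {1..n} - {n - 1} \<Longrightarrow> x l \<in> L (d l); m \<in> M c\<rbrakk> \<Longrightarrow>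
        \<omega> (n - 1) (bihom_args n \<alpha> \<beta> x) (\<beta>\<^sub>M m) =
          sM (- eps c (d n)) (\<omega> n (bihom_args n \<alpha> \<beta> (x(n - 1 := x n))) (\<alpha>\<^sub>M m))"
    and action_jacobi:
      "\<lbrakk>\<And>j. j \<in> {1..n - 1} \<Longrightarrow> x j \<in> L (d j); \<And>j. j \<in> {1..n - 1} \<Longrightarrow> y j \<in> L (e j); m \<in> M c\<rbrakk> \<Longrightarrow>
        \<omega> n (\<lambda>j. \<beta> (\<beta> (x j))) (\<omega> n (\<lambda>j. \<beta> (y j)) (\<alpha>\<^sub>M m)) =
          (\<Sum>i=1..n - 1. sM (eps (\<Sum>j=1..n - 1. d j) (\<Sum>l=1..<i. e l))
            (\<omega> n ((\<lambda>j. \<beta> (\<beta> (y j)))(i := br (bihom_args n \<alpha> \<beta> (x(n := y i))))) (\<beta>\<^sub>M (\<beta>\<^sub>M m))))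
          + sM (eps (\<Sum>j=1..n - 1. d j) (\<Sum>l=1..<n. e l))
            (\<omega> n (\<lambda>j. \<beta> (\<beta> (y j))) (\<omega> n (\<lambda>j. \<beta> (x j)) (\<alpha>\<^sub>M m)))"
    and action_bracket:
      "\<lbrakk>\<And>j. j \<in> {1..n - 2} \<Longrightarrow> x j \<in> L (d j); m \<in> M c; \<And>j. j \<in> {1..n} \<Longrightarrow> y j \<in> L (e j)\<rbrakk> \<Longrightarrow>
        \<omega> (n - 1) ((\<lambda>j. \<beta> (\<beta> (x j)))(n := br (bihom_args n \<alpha> \<beta> y))) (\<beta>\<^sub>M (\<beta>\<^sub>M m)) =
          (\<Sum>i=1..n. sM (eps ((\<Sum>j=1..n - 2. d j) + c) (\<Sum>l=1..<i. e l))
            (\<omega> i (\<lambda>j. \<beta> (\<beta> (y j)))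
              (\<omega> (n - 1) (bihom_args n \<alpha> \<beta> (x(n := y i))) (\<beta>\<^sub>M m))))"

end

theory Submission
  imports Defs
begin

text \<open>Each axiom for the twisted action at algebra elements \<open>x\<close>, \<open>y\<close>
  is the same axiom for \<open>\<omega>\<close> at their images under \<gamma>. Since \<gamma> is
  even, the images have the same degrees, so all \<open>eps\<close> factors agree. Since \<gamma>
  commutes with \<alpha>, \<beta> and the bracket, it moves through every argument down to the
  variables. Module slots, including those filled by an inner action, are not touched by \<gamma>.
  Multilinearity survives by \<open>multilinear_on_comp_linear\<close>.\<close>

lemma comp_fun_upd_lambda: "(\<lambda>j. f ((x(k := u)) j)) = (\<lambda>j. f (x j))(k := f u)"
  by auto

lemma comp_bihom_args:
  assumes "\<gamma> \<circ> \<alpha> = \<alpha> \<circ> \<gamma>" "\<gamma> \<circ> \<beta> = \<beta> \<circ> \<gamma>"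
  shows "(\<lambda>j. \<gamma> (bihom_args n \<alpha> \<beta> x j)) = bihom_args n \<alpha> \<beta> (\<lambda>j. \<gamma> (x j))"
  using assms by (auto simp: bihom_args_def fun_eq_iff)

text \<open>In each single slot the new map is the old slot map, taken at the tuple of images,
  composed with the linear \<open>g\<close>.\<close>

lemma multilinear_on_comp_linear:
  assumes "multilinear_on s t J f" "Vector_Spaces.linear s s g"
  shows "multilinear_on s t J (\<lambda>x. f (\<lambda>j. g (x j)))"
proof -
  have "Vector_Spaces.linear s t (\<lambda>u. f (\<lambda>i. g ((x(j := u)) i)))" if "j \<in> J" for x j
  proof -
    have "Vector_Spaces.linear s t (\<lambda>u. f ((\<lambda>i. g (x i))(j := u)))"
      using assms(1) that by (simp add: multilinear_on_def)
    from Vector_Spaces.linear_compose[OF assms(2) this] show ?thesis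
      unfolding comp_fun_upd_lambda comp_def .
  qed
  moreover have "f (\<lambda>j. g (x j)) = f (\<lambda>j. g (y j))" if "\<forall>j\<in>J. x j = y j" for x y
    using assms(1) that unfolding multilinear_on_def by (metis (no_types, lifting))
  ultimately show ?thesis
    by (simp add: multilinear_on_def)
qed

theorem theorem4p4:
  fixes n :: nat
    and sL :: "'k::field \<Rightarrow> 'l::ab_group_add \<Rightarrow> 'l"
    and L :: "'g::ab_group_add \<Rightarrow> 'l set"
    and br :: "(nat \<Rightarrow> 'l) \<Rightarrow> 'l"
    and eps :: "'g \<Rightarrow> 'g \<Rightarrow> 'k"
    and \<alpha> \<beta> \<gamma> :: "'l \<Rightarrow> 'l"
    and sM :: "'k \<Rightarrow> 'm::ab_group_add \<Rightarrow> 'm"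
    and M :: "'g \<Rightarrow> 'm set"
    and \<alpha>\<^sub>M \<beta>\<^sub>M :: "'m \<Rightarrow> 'm"
    and \<omega> :: "nat \<Rightarrow> (nat \<Rightarrow> 'l) \<Rightarrow> 'm \<Rightarrow> 'm"
  assumes "CHAR('k) \<noteq> 2"
    and "n_bihom_lie_color_algebra n sL L br eps \<alpha> \<beta>"
    and "n_bihom_lie_module n sL L br eps \<alpha> \<beta> sM M \<alpha>\<^sub>M \<beta>\<^sub>M \<omega>"
    and "bihom_endomorphism n sL L br \<alpha> \<beta> \<gamma>"
  shows "n_bihom_lie_module n sL L br eps \<alpha> \<beta> sM M \<alpha>\<^sub>M \<beta>\<^sub>M
    (\<lambda>i x m. \<omega> i (\<lambda>j. \<gamma> (x j)) m)"
proof -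
  interpret n_bihom_lie_module n sL L br eps \<alpha> \<beta> sM M \<alpha>\<^sub>M \<beta>\<^sub>M \<omega>
    by fact
  have lin: "Vector_Spaces.linear sL sL \<gamma>"
    and hom: "v \<in> L a \<Longrightarrow> \<gamma> v \<in> L a"
    and comm: "\<gamma> \<circ> \<alpha> = \<alpha> \<circ> \<gamma>" "\<gamma> \<circ> \<beta> = \<beta> \<circ> \<gamma>"
    and br: "\<gamma> (br x) = br (\<lambda>j. \<gamma> (x j))" for v a x
    using assms(4) by (auto simp: bihom_endomorphism_def even_linear_def)
  have \<beta>: "\<gamma> (\<beta> v) = \<beta> (\<gamma> v)" for v
    using comm(2) by (auto simp: fun_eq_iff)
  have compose: "(\<lambda>j. \<gamma> ((x \<circ> p) j)) = (\<lambda>j. \<gamma> (x j)) \<circ> p" for x :: "nat \<Rightarrow> 'l" and p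
    by auto
  \<comment> \<open>These equations drive \<gamma> inward through twists, slot updates, brackets and
    transpositions, until the tuples are built from
    \<open>\<lambda>j. \<gamma> (x j)\<close>.\<close>
  note push = comp_bihom_args[OF comm] comp_fun_upd_lambda br \<beta> compose
  show ?thesis
  proof (intro n_bihom_lie_module.intro n_bihom_lie_module_axioms.intro
      n_bihom_lie_color_algebra_axioms M.bihom_module_axioms, goal_cases)
    case (1 i m)
    then show ?case using multilinear_on_comp_linear[OF multilinear_action lin] by blast
  next
    case (2 i x)
    then show ?case using linear_action by simp
  next
    case (3 i j k x d m c m')
    \<comment> \<open>By \<open>hom\<close> the degrees \<open>d\<close> of \<open>x\<close> also
      serve for the images, so \<open>swap_factor\<close> is unchanged.\<close>
    then show ?case unfolding push by (intro action_skew hom) auto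
  next
    case (4 i x d m c)
    then show ?case unfolding push by (intro action_shift hom) auto
  next
    case (5 x d m c)
    then show ?case unfolding push by (intro action_shift_last hom) auto
  next
    case (6 x d y e m c)
    \<comment> \<open>The bracket in slot \<open>i\<close> stands under \<gamma>; \<open>br\<close>
      turns it into the bracket of the images, as the axiom for \<open>\<omega>\<close>
      requires.\<close>
    then show ?case unfolding push by (intro action_jacobi hom) auto
  next
    case (7 x d m c y e)
    then show ?case unfolding push by (intro action_bracket hom) auto
  qed
qed

end
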